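(* Let $K,N_r,N_d\ge1$ be integers and $\eta,\xi_1,\dots,\xi_K>0$. Let $\mathbf{H}=[\mathbf{h}_1,\dots,\mathbf{h}_K]\in\mathbb{C}^{N_r\times K}$ and $\mathbf{G}\in\mathbb{C}^{N_d\times N_r}$ be independent random matrices, where $\mathbf{h}_j\sim\mathcal{CN}(\mathbf{0}_{N_r},\xi_j\mathbf{I}_{N_r})$ for $j=1,\dots,K$ and the entries of $\mathbf{G}$ are i.i.d. $\mathcal{CN}(0,\eta)$. Let $\mathbf{W}_a\in\mathbb{C}^{K\times N_d}$ be the phase-aligning matrix with entries $[\mathbf{W}_a]_{ij}=\frac{1}{\sqrt{N_d}}e^{\mathrm{j}\phi_{ij}}$, where $\phi_{ij}=\angle\left[(\mathbf{G}\mathbf{H})^H\right]_{ij}$ and $\mathrm{j}$ in the exponent is the imaginary unit. Then for every $k\in\{1,\dots,K\}$, $$\mathbb{E}\left\{\left[\mathbf{W}_a\mathbf{G}\mathbf{G}^H\mathbf{W}_a^H\right]_{kk}\right\}=\eta\left(\frac{\pi}{4}N_d+N_r-\frac{\pi}{4}\right).$$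
   Context: $\mathcal{CN}(\mathbf{0},c\,\mathbf{I})$ is the circularly symmetric complex Gaussian distribution with covariance $c\,\mathbf{I}$. $(\cdot)^H$ is the conjugate transpose, $[\cdot]_{ij}$ the $(i,j)$ entry, and $\angle z$ the phase of a nonzero complex number $z$ (all entries of $\mathbf{GH}$ are almost surely nonzero). *)

theory Defs
  imports "HOL-Probability.Probability"
begin

text \<open>
  Densities, with respect to Lebesgue measure on the underlying real space, of the circularly
  symmetric complex Gaussian distributions CN(0, c) on the complex numbers and CN(0, c I) on complex
  n-space, for \<open>c > 0\<close>. The parameter c is the variance of a complex coordinate, so the real and
  imaginary parts each have variance c/2; this is where the normalisation without a factor 2 comes
  from.
\<close>

definition cn_density :: "real \<Rightarrow> complex \<Rightarrow> real" where
  "cn_density c z = exp (- (cmod z)\<^sup>2 / c) / (pi * c)"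

definition cn_vec_density :: "real \<Rightarrow> complex ^ 'n::finite \<Rightarrow> real" where
  "cn_vec_density c z = exp (- (norm z)\<^sup>2 / c) / (pi * c) ^ CARD('n)"

text \<open>
  The library's \<open>indep_var\<close> forces both variables to have the same value type. This version
  states independence of the generated sigma-algebras for variables of different types.
\<close>

definition indep_random_variables ::
  "'a measure \<Rightarrow> 'b measure \<Rightarrow> ('a \<Rightarrow> 'b) \<Rightarrow> 'c measure \<Rightarrow> ('a \<Rightarrow> 'c) \<Rightarrow> bool" where
  "indep_random_variables M S X T Y \<longleftrightarrow>
     X \<in> measurable M S \<and> Y \<in> measurable M T \<and>
     prob_space.indep_set M {X -` A \<inter> space M | A. A \<in> sets S} {Y -` B \<inter> space M | B. B \<in> sets T}"

definition conj_transpose :: "complex ^ 'n ^ 'm \<Rightarrow> complex ^ 'm ^ 'n" where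
  "conj_transpose A = (\<chi> i j. cnj (A $ j $ i))"

text \<open>
  The number of columns of the result is the number of rows of G. For a zero entry the phase
  takes the library's default value \<open>Arg 0 = 0\<close>.
\<close>

definition phase_aligning ::
  "complex ^ 'r ^ 'd \<Rightarrow> complex ^ 'k ^ 'r \<Rightarrow> complex ^ 'd::finite ^ 'k" where
  "phase_aligning G H = (\<chi> i j.
     complex_of_real (1 / sqrt (real CARD('d))) *
     exp (\<i> * complex_of_real (Arg (conj_transpose (G ** H) $ i $ j))))"

end

theory Submission
  imports Defs
begin

text \<open>
  Condition on the column \<open>h\<close> of \<open>H\<close>, which is nonzero almost surely. With \<open>w\<^sub>i\<close> the conjugate phase
  of \<open>(G h)\<^sub>i\<close>, the diagonal entry is \<open>1/N\<^sub>d\<close> times the sum over \<open>l\<close>, \<open>i\<close> and \<open>j\<close> of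
  \<open>w\<^sub>i G\<^sub>i\<^sub>l\<close> times the conjugate of \<open>w\<^sub>j G\<^sub>j\<^sub>l\<close>. The terms with \<open>i = j\<close> have mean \<open>\<eta>\<close>. For \<open>i \<noteq> j\<close> the rows
  are independent, and the vector of the means of the \<open>w\<^sub>i G\<^sub>i\<^sub>l\<close> is \<open>K / |h|\<close> times the conjugate of
  \<open>h\<close>, where \<open>K\<^sup>2 = \<pi> \<eta> / 4\<close>; summing over \<open>l\<close>, each such pair contributes \<open>K\<^sup>2\<close>.
\<close>

section \<open>Lebesgue measure on the complex plane and the factorised Gaussian density\<close>

lemma measurable_Complex_pair [measurable]:
  "(\<lambda>(x, y). Complex x y) \<in> borel_measurable (borel \<Otimes>\<^sub>M borel)"
  unfolding Complex_eq case_prod_beta by measurable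

text \<open>Lebesgue measure is determined by its values on boxes, and a box of complex numbers is a
  product of two intervals. This lets a density on the plane be split into coordinates.\<close>

lemma lborel_complex:
  "(lborel :: complex measure) = distr (lborel \<Otimes>\<^sub>M lborel) borel (\<lambda>(x, y). Complex x y)"
proof (rule lborel_eqI)
  fix l u :: complex
  assume "\<And>b. b \<in> Basis \<Longrightarrow> l \<bullet> b \<le> u \<bullet> b"
  then have le: "Re l \<le> Re u" "Im l \<le> Im u"
    by (force simp: Basis_complex_def)+
  have "emeasure (distr (lborel \<Otimes>\<^sub>M lborel) borel (\<lambda>(x, y). Complex x y)) (box l u)
      = emeasure (lborel \<Otimes>\<^sub>M lborel) ({Re l<..<Re u} \<times> {Im l<..<Im u})"
    by (subst emeasure_distr)
      (auto simp: space_pair_measure box_def Basis_complex_def intro!: arg_cong2[where f=emeasure])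
  also have "\<dots> = ennreal (Re u - Re l) * ennreal (Im u - Im l)"
    using le by (subst lborel.emeasure_pair_measure_Times) auto
  also have "\<dots> = (\<Prod>b\<in>Basis. (u - l) \<bullet> b)"
    using le by (simp add: Basis_complex_def ennreal_mult)
  finally show "emeasure (distr (lborel \<Otimes>\<^sub>M lborel) borel (\<lambda>(x, y). Complex x y)) (box l u)
      = (\<Prod>b\<in>Basis. (u - l) \<bullet> b)" .
qed simp

lemma cn_density_eq_normal_density:
  assumes "c > 0"
  shows "cn_density c (Complex x y) = normal_density 0 (sqrt (c / 2)) x * normal_density 0 (sqrt (c / 2)) y"
proof -
  have "exp (- (x\<^sup>2 + y\<^sup>2) / c) = exp (- x\<^sup>2 / c) * exp (- y\<^sup>2 / c)"
    by (simp add: exp_add[symmetric] add_divide_distrib diff_divide_distrib)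
  then show ?thesis
    using assms by (simp add: cn_density_def normal_density_def cmod_power2)
qed

section \<open>Real marginals and moments of complex Gaussian variables\<close>

context prob_space
begin

text \<open>All three claims are read off the joint law of the two coordinates, whose density is a
  product: integrating one factor out gives a marginal, and equality with the product of the
  marginals gives independence.\<close>

lemma distributed_cn_Re_Im:
  assumes Z: "distributed M lborel Z (\<lambda>z. ennreal (cn_density c z))" and "c > 0"
  shows "distributed M lborel (\<lambda>\<omega>. Re (Z \<omega>)) (normal_density 0 (sqrt (c / 2)))"
    and "distributed M lborel (\<lambda>\<omega>. Im (Z \<omega>)) (normal_density 0 (sqrt (c / 2)))"
    and "indep_var borel (\<lambda>\<omega>. Re (Z \<omega>)) borel (\<lambda>\<omega>. Im (Z \<omega>))"
proof -
  let ?n = "normal_density 0 (sqrt (c / 2))"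
  have [measurable]: "cn_density c \<in> borel_measurable borel"
    unfolding cn_density_def by measurable
  have Zm[measurable]: "Z \<in> borel_measurable M"
    using distributed_measurable[OF Z] by simp
  have int: "(\<integral>\<^sup>+x. ennreal (?n x) \<partial>lborel) = 1"
  proof -
    interpret N: prob_space "density lborel ?n"
      using \<open>c > 0\<close> by (intro prob_space_normal_density) simp
    show ?thesis
      using N.emeasure_space_1 by (simp add: emeasure_density)
  qed
  have "distr M (lborel \<Otimes>\<^sub>M lborel) (\<lambda>\<omega>. (Re (Z \<omega>), Im (Z \<omega>)))
      = distr (distr M lborel Z) (lborel \<Otimes>\<^sub>M lborel) (\<lambda>z. (Re z, Im z))"
    by (subst distr_distr) (auto simp: comp_def)
  also have "\<dots> = distr (density (distr (lborel \<Otimes>\<^sub>M lborel) borel (\<lambda>(x, y). Complex x y))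
      (\<lambda>z. ennreal (cn_density c z))) (lborel \<Otimes>\<^sub>M lborel) (\<lambda>z. (Re z, Im z))"
    by (simp add: distributed_distr_eq_density[OF Z] flip: lborel_complex)
  \<comment> \<open>Pushing forward along \<open>Complex\<close> and back to coordinates is the
    identity, so only the pulled-back density remains.\<close>
  also have "\<dots> = density (lborel \<Otimes>\<^sub>M lborel) ((\<lambda>z. ennreal (cn_density c z)) \<circ> (\<lambda>(x, y). Complex x y))"
    by (rule distr_density_distr) auto
  also have "(\<lambda>z. ennreal (cn_density c z)) \<circ> (\<lambda>(x, y). Complex x y)
      = (\<lambda>(x, y). ennreal (?n x) * ennreal (?n y))"
    using \<open>c > 0\<close> by (auto simp: cn_density_eq_normal_density ennreal_mult fun_eq_iff)
  finally have joint: "distributed M (lborel \<Otimes>\<^sub>M lborel) (\<lambda>\<omega>. (Re (Z \<omega>), Im (Z \<omega>)))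
      (\<lambda>(x, y). ennreal (?n x) * ennreal (?n y))"
    by (simp add: distributed_def)
  show Re: "distributed M lborel (\<lambda>\<omega>. Re (Z \<omega>)) ?n"
    using distr_marginal1[OF sigma_finite_lborel sigma_finite_lborel joint] int
    by (simp add: nn_integral_cmult)
  show Im: "distributed M lborel (\<lambda>\<omega>. Im (Z \<omega>)) ?n"
    using distr_marginal2[OF sigma_finite_lborel sigma_finite_lborel joint] int
    by (simp add: nn_integral_multc)
  have "distr M lborel (\<lambda>\<omega>. Re (Z \<omega>)) \<Otimes>\<^sub>M distr M lborel (\<lambda>\<omega>. Im (Z \<omega>))
      = distr M (lborel \<Otimes>\<^sub>M lborel) (\<lambda>\<omega>. (Re (Z \<omega>), Im (Z \<omega>)))"
    unfolding distributed_distr_eq_density[OF Re] distributed_distr_eq_density[OF Im]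
      distributed_distr_eq_density[OF joint]
    using \<open>c > 0\<close>
    by (intro pair_measure_density sigma_finite_lborel prob_space_imp_sigma_finite prob_space_normal_density) auto
  then have "indep_var lborel (\<lambda>\<omega>. Re (Z \<omega>)) lborel (\<lambda>\<omega>. Im (Z \<omega>))"
    by (simp add: indep_var_distribution_eq)
  from indep_var_compose[OF this, of id borel id borel]
  show "indep_var borel (\<lambda>\<omega>. Re (Z \<omega>)) borel (\<lambda>\<omega>. Im (Z \<omega>))"
    by (simp add: comp_def)
qed

text \<open>Transfers moment formulas for normal densities to expectations, integrability
  included.\<close>

lemma distributed_has_bochner_integral:
  fixes f :: "'b \<Rightarrow> real" and g :: "'b \<Rightarrow> 'c::{banach, second_countable_topology}"
  assumes X: "distributed M N X f" and [measurable]: "f \<in> borel_measurable N" "g \<in> borel_measurable N"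
    and "\<And>x. 0 \<le> f x" and I: "has_bochner_integral N (\<lambda>x. f x *\<^sub>R g x) r"
  shows "has_bochner_integral M (\<lambda>\<omega>. g (X \<omega>)) r"
proof -
  have "has_bochner_integral (distr M N X) g r"
    unfolding distributed_distr_eq_density[OF X]
    using assms by (intro has_bochner_integral_density) auto
  then show ?thesis
    using distributed_measurable[OF X]
    by (simp add: has_bochner_integral_iff integrable_distr_eq integral_distr)
qed

lemma distributed_normal_cmult:
  assumes "distributed M lborel X (normal_density 0 \<sigma>)" "0 < \<sigma>" "a \<noteq> 0"
  shows "distributed M lborel (\<lambda>\<omega>. a * X \<omega>) (normal_density 0 (\<bar>a\<bar> * \<sigma>))"
  using normal_density_affine[OF assms, of 0] by simp

text \<open>The real part is \<open>Re a * Re (Z \<omega>) - Im a * Im (Z \<omega>)\<close>, a sum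
  of independent centred normals whose variances add up to
  \<open>(cmod a)\<^sup>2 * c / 2\<close>.\<close>

lemma distributed_cn_Re_mult:
  assumes Z: "distributed M lborel Z (\<lambda>z. ennreal (cn_density c z))" and "c > 0" and "a \<noteq> 0"
  shows "distributed M lborel (\<lambda>\<omega>. Re (a * Z \<omega>)) (normal_density 0 (cmod a * sqrt (c / 2)))"
proof -
  note RI = distributed_cn_Re_Im[OF Z \<open>c > 0\<close>]
  have pos: "sqrt (c / 2) > 0"
    using \<open>c > 0\<close> by simp
  \<comment> \<open>A vanishing coefficient would give a degenerate law without density, so purely
    real and purely imaginary \<open>a\<close> are treated apart.\<close>
  consider "Re a = 0" "Im a \<noteq> 0" | "Im a = 0" "Re a \<noteq> 0" | "Re a \<noteq> 0" "Im a \<noteq> 0"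
    using \<open>a \<noteq> 0\<close> by (auto simp: complex_eq_iff)
  then show ?thesis
  proof cases
    case 1
    then show ?thesis
      using distributed_normal_cmult[OF RI(2) pos, of "- Im a"] by (simp add: cmod_def)
  next
    case 2
    then show ?thesis
      using distributed_normal_cmult[OF RI(1) pos, of "Re a"] by (simp add: cmod_def)
  next
    case 3
    have "indep_var borel (\<lambda>\<omega>. Re a * Re (Z \<omega>)) borel (\<lambda>\<omega>. - Im a * Im (Z \<omega>))"
      using indep_var_compose[OF RI(3), of "\<lambda>x. Re a * x" borel "\<lambda>x. - Im a * x" borel]
      by (simp add: comp_def)
    from add_indep_normal[OF this _ _ distributed_normal_cmult[OF RI(1) pos] distributed_normal_cmult[OF RI(2) pos]]
    have "distributed M lborel (\<lambda>\<omega>. Re a * Re (Z \<omega>) + - Im a * Im (Z \<omega>))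
        (normal_density 0 (sqrt ((\<bar>Re a\<bar> * sqrt (c / 2))\<^sup>2 + (\<bar>- Im a\<bar> * sqrt (c / 2))\<^sup>2)))"
      using 3 pos by simp
    also have "sqrt ((\<bar>Re a\<bar> * sqrt (c / 2))\<^sup>2 + (\<bar>- Im a\<bar> * sqrt (c / 2))\<^sup>2) = cmod a * sqrt (c / 2)"
      unfolding power_mult_distrib distrib_right[symmetric] real_sqrt_mult cmod_def
      using \<open>c > 0\<close> by simp
    finally show ?thesis
      by simp
  qed
qed

lemma cn_second_moment:
  assumes Z: "distributed M lborel Z (\<lambda>z. ennreal (cn_density c z))" and "c > 0"
  shows "integrable M (\<lambda>\<omega>. (cmod (Z \<omega>))\<^sup>2)" and "expectation (\<lambda>\<omega>. (cmod (Z \<omega>))\<^sup>2) = c"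
proof -
  have moment: "has_bochner_integral M (\<lambda>\<omega>. (X \<omega>)\<^sup>2) (c / 2)"
    if X: "distributed M lborel X (normal_density 0 (sqrt (c / 2)))" for X
    using normal_moment_even[of "sqrt (c / 2)" 0 1] \<open>c > 0\<close>
    by (intro distributed_has_bochner_integral[OF X]) auto
  have "has_bochner_integral M (\<lambda>\<omega>. (Re (Z \<omega>))\<^sup>2 + (Im (Z \<omega>))\<^sup>2) (c / 2 + c / 2)"
    by (intro has_bochner_integral_add moment distributed_cn_Re_Im[OF assms])
  then show "integrable M (\<lambda>\<omega>. (cmod (Z \<omega>))\<^sup>2)" "expectation (\<lambda>\<omega>. (cmod (Z \<omega>))\<^sup>2) = c"
    by (auto simp: cmod_power2 has_bochner_integral_iff)
qed

text \<open>For \<open>b \<noteq> 0\<close> the real part is centred normal with variance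
  \<open>(norm b)\<^sup>2 * c / 2\<close>, and a centred normal variable with standard deviation
  \<sigma> has absolute mean \<open>\<sigma> * sqrt (2 / pi)\<close>.\<close>

lemma cn_linear_combination_abs_Re:
  fixes Z :: "'i::finite \<Rightarrow> 'a \<Rightarrow> complex" and b :: "complex ^ 'i"
  assumes Z: "\<And>i. distributed M lborel (Z i) (\<lambda>z. ennreal (cn_density c z))" and "c > 0"
    and indep: "indep_vars (\<lambda>_. borel) Z UNIV"
  shows "has_bochner_integral M (\<lambda>\<omega>. \<bar>Re (\<Sum>i\<in>UNIV. b $ i * Z i \<omega>)\<bar>) (norm b * sqrt (c / pi))"
proof (cases "b = 0")
  case True
  then show ?thesis by (simp add: has_bochner_integral_zero)
next
  case False
  \<comment> \<open>Terms with zero coefficient have no density; dropping them does not change the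
    sum.\<close>
  define I where "I = {i. b $ i \<noteq> 0}"
  define \<sigma> where "\<sigma> = norm b * sqrt (c / 2)"
  let ?X = "\<lambda>\<omega>. Re (\<Sum>i\<in>UNIV. b $ i * Z i \<omega>)"
  have "I \<noteq> {}"
    using False by (auto simp: I_def vec_eq_iff)
  have "\<sigma> > 0"
    using False \<open>c > 0\<close> by (simp add: \<sigma>_def)
  have "indep_vars (\<lambda>_. borel) (\<lambda>i \<omega>. Re (b $ i * Z i \<omega>)) I"
    by (rule indep_vars_compose2[OF indep_vars_subset[OF indep]]) auto
  then have "distributed M lborel (\<lambda>\<omega>. \<Sum>i\<in>I. Re (b $ i * Z i \<omega>))
      (normal_density (\<Sum>i\<in>I. 0) (sqrt (\<Sum>i\<in>I. (cmod (b $ i) * sqrt (c / 2))\<^sup>2)))"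
    using \<open>I \<noteq> {}\<close> \<open>c > 0\<close>
    by (intro sum_indep_normal distributed_cn_Re_mult[OF Z]) (auto simp: I_def)
  also have "(\<lambda>\<omega>. \<Sum>i\<in>I. Re (b $ i * Z i \<omega>)) = ?X"
    unfolding Re_sum by (intro ext sum.mono_neutral_left) (auto simp: I_def)
  also have "sqrt (\<Sum>i\<in>I. (cmod (b $ i) * sqrt (c / 2))\<^sup>2) = \<sigma>"
  proof -
    have "(\<Sum>i\<in>I. (cmod (b $ i))\<^sup>2) = (\<Sum>i\<in>UNIV. (cmod (b $ i))\<^sup>2)"
      by (intro sum.mono_neutral_left) (auto simp: I_def)
    then show ?thesis
      using \<open>c > 0\<close> unfolding \<sigma>_def power_mult_distrib sum_distrib_right[symmetric]
      by (simp add: norm_vec_def L2_set_def real_sqrt_mult real_sqrt_divide)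
  qed
  finally have X: "distributed M lborel ?X (normal_density 0 \<sigma>)"
    by simp
  have "has_bochner_integral M (\<lambda>\<omega>. \<bar>?X \<omega>\<bar>) (\<sigma> * sqrt (2 / pi))"
    using normal_moment_abs_odd[OF \<open>\<sigma> > 0\<close>, of 0 0]
    by (intro distributed_has_bochner_integral[OF X]) auto
  also have "\<sigma> * sqrt (2 / pi) = norm b * sqrt (c / pi)"
    by (simp add: \<sigma>_def real_sqrt_divide real_sqrt_mult)
  finally show ?thesis .
qed

end

section \<open>Recovering the modulus from rotated real parts\<close>

text \<open>In polar form the integrand is \<open>cmod z * \<bar>cos (t + \<alpha>)\<bar>\<close>,
  and the absolute cosine has integral 2 over any interval of length pi, its period.\<close>

lemma has_integral_abs_Re_rotation:
  "((\<lambda>t. \<bar>Re (cis t * z)\<bar>) has_integral 2 * cmod z) {0..pi}"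
proof -
  have main: "((\<lambda>t. \<bar>Re (cis t * z)\<bar>) has_integral 2 * cmod z) {0..pi}" if "Re z \<ge> 0" for z
  proof -
    \<comment> \<open>Since \<open>Re z \<ge> 0\<close> puts \<alpha> between -pi/2 and pi/2, the
      cosine on [0, pi] is nonnegative up to \<open>s\<close> and nonpositive after it.\<close>
    define \<alpha> s where "\<alpha> = Arg z" and "s = pi / 2 - \<alpha>"
    have z: "z = rcis (cmod z) \<alpha>"
      by (simp add: \<alpha>_def rcis_cmod_Arg)
    have eq: "cis t * z = rcis (cmod z) (t + \<alpha>)" for t
      by (subst z) (simp add: rcis_def cis_mult mult_ac add.commute)
    have Re: "Re (cis t * z) = cmod z * cos (t + \<alpha>)" for t
      by (simp add: eq)
    have \<alpha>: "\<bar>\<alpha>\<bar> \<le> pi / 2"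
      using that Arg_Re_nonneg[of z] by (simp add: \<alpha>_def)
    then have s: "0 \<le> s" "s \<le> pi"
      by (auto simp: s_def)
    have "((\<lambda>t. cmod z * cos (t + \<alpha>)) has_integral cmod z * sin (s + \<alpha>) - cmod z * sin (0 + \<alpha>)) {0..s}"
      using s by (intro fundamental_theorem_of_calculus)
        (auto intro!: derivative_eq_intros simp flip: has_real_derivative_iff_has_vector_derivative)
    then have "((\<lambda>t. \<bar>Re (cis t * z)\<bar>) has_integral cmod z * sin (s + \<alpha>) - cmod z * sin (0 + \<alpha>)) {0..s}"
    proof (rule has_integral_eq[rotated])
      fix t assume "t \<in> {0..s}"
      then have "cos (t + \<alpha>) \<ge> 0"
        using \<alpha> by (intro cos_ge_zero) (auto simp: s_def)
      then show "cmod z * cos (t + \<alpha>) = \<bar>Re (cis t * z)\<bar>"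
        unfolding Re by (simp add: abs_mult)
    qed
    moreover have "((\<lambda>t. - (cmod z * cos (t + \<alpha>))) has_integral
        - (cmod z * sin (pi + \<alpha>)) - - (cmod z * sin (s + \<alpha>))) {s..pi}"
      using s by (intro fundamental_theorem_of_calculus)
        (auto intro!: derivative_eq_intros simp flip: has_real_derivative_iff_has_vector_derivative)
    then have "((\<lambda>t. \<bar>Re (cis t * z)\<bar>) has_integral
        - (cmod z * sin (pi + \<alpha>)) - - (cmod z * sin (s + \<alpha>))) {s..pi}"
    proof (rule has_integral_eq[rotated])
      fix t assume "t \<in> {s..pi}"
      then have "cos (t + \<alpha> - pi) \<ge> 0"
        using \<alpha> by (intro cos_ge_zero) (auto simp: s_def)
      then have "cos (t + \<alpha>) \<le> 0"
        by (simp add: cos_diff)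
      then show "- (cmod z * cos (t + \<alpha>)) = \<bar>Re (cis t * z)\<bar>"
        unfolding Re by (simp add: abs_mult)
    qed
    ultimately have "((\<lambda>t. \<bar>Re (cis t * z)\<bar>) has_integral
        (cmod z * sin (s + \<alpha>) - cmod z * sin (0 + \<alpha>)) +
        (- (cmod z * sin (pi + \<alpha>)) - - (cmod z * sin (s + \<alpha>)))) {0..pi}"
      using s by (intro has_integral_combine[of 0 s pi]) auto
    then show ?thesis
      by (simp add: s_def sin_add)
  qed
  show ?thesis
  proof (cases "Re z \<ge> 0")
    case True
    then show ?thesis by (rule main)
  next
    case False
    then show ?thesis
      using main[of "- z"] by (simp add: abs_minus_commute)
  qed
qed

context prob_space
begin

text \<open>
  Up to the factor \<open>2\<close>, the modulus is the integral of the absolute real part over all rotations by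
  angles in \<open>[0, \<pi>]\<close>, so only the law of one-dimensional marginals is needed.
\<close>

lemma cn_linear_combination_cmod:
  fixes Z :: "'i::finite \<Rightarrow> 'a \<Rightarrow> complex" and b :: "complex ^ 'i"
  assumes Z: "\<And>i. distributed M lborel (Z i) (\<lambda>z. ennreal (cn_density c z))" and "c > 0"
    and indep: "indep_vars (\<lambda>_. borel) Z UNIV"
  shows "has_bochner_integral M (\<lambda>\<omega>. cmod (\<Sum>i\<in>UNIV. b $ i * Z i \<omega>)) (sqrt (pi * c) / 2 * norm b)"
proof -
  define u where "u \<omega> = (\<Sum>i\<in>UNIV. b $ i * Z i \<omega>)" for \<omega>
  have [measurable]: "Z i \<in> borel_measurable M" for i
    using distributed_measurable[OF Z] by simp
  have [measurable]: "u \<in> borel_measurable M"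
    unfolding u_def by measurable
  have [measurable]: "cis \<in> borel_measurable borel"
    by (intro borel_measurable_continuous_onI continuous_intros)
  interpret P: pair_sigma_finite lborel M ..
  \<comment> \<open>The rotation can be absorbed into the coefficients without changing their norm,
    so every angle yields the same mean.\<close>
  have marginal: "(\<integral>\<^sup>+\<omega>. ennreal \<bar>Re (cis t * u \<omega>)\<bar> \<partial>M) = ennreal (norm b * sqrt (c / pi))" for t
  proof -
    have "norm (\<chi> i. cis t * b $ i) = norm b"
      by (simp add: norm_vec_def norm_mult)
    moreover have "(\<Sum>i\<in>UNIV. (\<chi> i. cis t * b $ i) $ i * Z i \<omega>) = cis t * u \<omega>" for \<omega>
      by (simp add: u_def sum_distrib_left mult.assoc)
    ultimately have "has_bochner_integral M (\<lambda>\<omega>. \<bar>Re (cis t * u \<omega>)\<bar>) (norm b * sqrt (c / pi))"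
      using cn_linear_combination_abs_Re[OF assms, of "\<chi> i. cis t * b $ i"] by simp
    then show ?thesis
      by (subst nn_integral_eq_integral) (auto simp: has_bochner_integral_iff)
  qed
  \<comment> \<open>With nonnegative integrals Fubini applies before integrability of the modulus is
    known; integrability comes out at the end.\<close>
  have "2 * (\<integral>\<^sup>+\<omega>. cmod (u \<omega>) \<partial>M) = (\<integral>\<^sup>+\<omega>. ennreal (2 * cmod (u \<omega>)) \<partial>M)"
    by (simp add: ennreal_mult nn_integral_cmult)
  also have "\<dots> = (\<integral>\<^sup>+\<omega>. \<integral>\<^sup>+t. ennreal (indicator {0..pi} t * \<bar>Re (cis t * u \<omega>)\<bar>) \<partial>lborel \<partial>M)"
    by (intro nn_integral_cong nn_integral_has_integral_lebesgue[symmetric] has_integral_abs_Re_rotation) auto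
  also have "\<dots> = (\<integral>\<^sup>+t. \<integral>\<^sup>+\<omega>. ennreal (indicator {0..pi} t * \<bar>Re (cis t * u \<omega>)\<bar>) \<partial>M \<partial>lborel)"
    by (rule P.Fubini') measurable
  also have "\<dots> = (\<integral>\<^sup>+t. ennreal (norm b * sqrt (c / pi)) * indicator {0..pi} t \<partial>lborel)"
    by (intro nn_integral_cong) (auto simp: indicator_def marginal[simplified])
  also have "\<dots> = ennreal (norm b * sqrt (c / pi)) * ennreal pi"
    by (simp add: nn_integral_cmult)
  also have "\<dots> = ennreal (2 * (sqrt (pi * c) / 2 * norm b))"
  proof -
    have "sqrt (c / pi) * pi = sqrt (pi * c)"
      using \<open>c > 0\<close> by (simp add: real_sqrt_divide real_sqrt_mult field_simps)
    then show ?thesis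
      by (simp flip: ennreal_mult add: mult_ac \<open>c > 0\<close> less_imp_le)
  qed
  also have "\<dots> = 2 * ennreal (sqrt (pi * c) / 2 * norm b)"
    using \<open>c > 0\<close> by (subst ennreal_mult) auto
  finally have "(\<integral>\<^sup>+\<omega>. cmod (u \<omega>) \<partial>M) = ennreal (sqrt (pi * c) / 2 * norm b)"
    by (simp add: ennreal_mult_cancel_left)
  then show ?thesis
    unfolding u_def[symmetric] using \<open>c > 0\<close> by (intro has_bochner_integral_nn_integral) auto
qed

end

section \<open>Conjugate phases and the equality case of a linear bound\<close>

text \<open>The entry of \<open>phase_aligning\<close> without its normalising factor, as a function
  of an entry of \<open>G ** H\<close>; \<open>cnj\<close> comes from the conjugate transpose in the
  phase.\<close>

definition conj_phase :: "complex \<Rightarrow> complex" where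
  "conj_phase z = exp (\<i> * complex_of_real (Arg (cnj z)))"

lemma norm_conj_phase [simp]: "cmod (conj_phase z) = 1"
  by (simp add: conj_phase_def)

lemma conj_phase_mult_self: "conj_phase z * z = of_real (cmod z)"
proof -
  have "z = cnj (rcis (cmod z) (Arg (cnj z)))"
    using rcis_cmod_Arg[of "cnj z"] by simp
  then have "z = of_real (cmod z) * cnj (conj_phase z)"
    by (simp add: conj_phase_def rcis_def cis_conv_exp)
  then have "conj_phase z * z = of_real (cmod z) * (conj_phase z * cnj (conj_phase z))"
    by (metis mult.left_commute)
  then show ?thesis
    by (simp add: complex_norm_square[symmetric])
qed

text \<open>A form without \<open>Arg\<close>, from which measurability is immediate. The value 1 at
  zero reflects \<open>Arg 0 = 0\<close>.\<close>

lemma conj_phase_eq: "conj_phase z = (if z = 0 then 1 else of_real (cmod z) / z)"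
  using conj_phase_mult_self[of z]
  by (auto simp: nonzero_eq_divide_eq) (simp add: conj_phase_def Arg_zero)

lemma measurable_conj_phase [measurable]: "conj_phase \<in> borel_measurable borel"
  unfolding conj_phase_eq[abs_def] by measurable

lemma inner_complex_vec: "(v :: complex ^ 'i::finite) \<bullet> w = Re (\<Sum>i\<in>UNIV. v $ i * cnj (w $ i))"
  by (simp add: inner_vec_def inner_complex_def)

text \<open>Taking \<open>y = x\<close> in the bound gives \<open>norm x \<le> K\<close>. By the
  equality at \<open>v\<close>, the squared norm of the difference expands to
  \<open>(norm x)\<^sup>2 - K\<^sup>2\<close>, which is therefore at most zero.\<close>

lemma eq_scaleR_if_inner_le:
  fixes x v :: "'v::real_inner"
  assumes le: "\<And>y. x \<bullet> y \<le> K * norm y" and eq: "x \<bullet> v = K * norm v" and "v \<noteq> 0"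
  shows "x = (K / norm v) *\<^sub>R v"
proof -
  have "norm x * norm x \<le> K * norm x"
    using le[of x] by (simp add: dot_square_norm power2_eq_square)
  \<comment> \<open>The choice \<open>y = - v\<close> makes \<open>K\<close> nonnegative, which
    settles the case \<open>x = 0\<close>, where \<open>norm x\<close> cannot be cancelled.\<close>
  moreover have "0 \<le> K"
    using le[of "- v"] \<open>v \<noteq> 0\<close> by (simp add: eq zero_le_mult_iff)
  ultimately have "norm x \<le> K"
    by (cases "x = 0") auto
  then have "(norm x)\<^sup>2 \<le> K\<^sup>2"
    by (intro power_mono) auto
  moreover have "(norm (x - (K / norm v) *\<^sub>R v))\<^sup>2 = (norm x)\<^sup>2 - K\<^sup>2"
    using \<open>v \<noteq> 0\<close>
    by (simp add: power2_norm_eq_inner inner_diff_left inner_diff_right inner_commute[of v x] eq)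
      (simp add: dot_square_norm power2_eq_square field_simps)
  ultimately have "(norm (x - (K / norm v) *\<^sub>R v))\<^sup>2 \<le> 0"
    by simp
  then show ?thesis
    by simp
qed

section \<open>Mean of a phase-weighted Gaussian vector\<close>

context prob_space
begin

lemma cn_integrable:
  assumes Z: "distributed M lborel Z (\<lambda>z. ennreal (cn_density c z))" and "c > 0"
  shows "integrable M Z"
proof (rule square_integrable_imp_integrable)
  show [measurable]: "Z \<in> borel_measurable M"
    using distributed_measurable[OF Z] by simp
  show "integrable M (\<lambda>\<omega>. (Z \<omega>)\<^sup>2)"
    by (rule Bochner_Integration.integrable_bound[OF cn_second_moment(1)[OF assms]]) (auto simp: norm_power)
qed

text \<open>
  The real inner product of the vector of these expectations with any \<open>b\<close> is at most
  \<open>\<E>|\<Sum> cnj b\<^sub>i Z\<^sub>i| = K |b|\<close>, with equality when \<open>b\<close> is the conjugate of \<open>h\<close>; this determines the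
  vector and replaces an appeal to unitary invariance.
\<close>

lemma cn_conj_phase_expectation:
  fixes Z :: "'i::finite \<Rightarrow> 'a \<Rightarrow> complex" and h :: "complex ^ 'i"
  assumes Z: "\<And>i. distributed M lborel (Z i) (\<lambda>z. ennreal (cn_density c z))" and "c > 0"
    and indep: "indep_vars (\<lambda>_. borel) Z UNIV" and "h \<noteq> 0"
  shows "expectation (\<lambda>\<omega>. conj_phase (\<Sum>j\<in>UNIV. Z j \<omega> * h $ j) * Z i \<omega>)
    = of_real (sqrt (pi * c) / 2 / norm h) * cnj (h $ i)"
proof -
  define K where "K = sqrt (pi * c) / 2"
  define w where "w \<omega> = conj_phase (\<Sum>j\<in>UNIV. Z j \<omega> * h $ j)" for \<omega>
  define L :: "complex ^ 'i" where "L = (\<chi> i. expectation (\<lambda>\<omega>. w \<omega> * Z i \<omega>))"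
  define h' :: "complex ^ 'i" where "h' = (\<chi> i. cnj (h $ i))"
  have [measurable]: "Z i \<in> borel_measurable M" for i
    using distributed_measurable[OF Z] by simp
  have [measurable]: "w \<in> borel_measurable M"
    unfolding w_def by measurable
  have norm_w: "cmod (w \<omega>) = 1" for \<omega>
    by (simp add: w_def)
  have int: "integrable M (\<lambda>\<omega>. w \<omega> * Z i \<omega>)" for i
    by (rule Bochner_Integration.integrable_bound[OF cn_integrable[OF Z \<open>c > 0\<close>, of i]])
      (auto simp: norm_mult norm_w)
  have L: "L \<bullet> b = expectation (\<lambda>\<omega>. Re (w \<omega> * (\<Sum>i\<in>UNIV. cnj (b $ i) * Z i \<omega>)))"
    and intL: "integrable M (\<lambda>\<omega>. Re (w \<omega> * (\<Sum>i\<in>UNIV. cnj (b $ i) * Z i \<omega>)))" for b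
  proof -
    have *: "w \<omega> * (\<Sum>i\<in>UNIV. cnj (b $ i) * Z i \<omega>) = (\<Sum>i\<in>UNIV. w \<omega> * Z i \<omega> * cnj (b $ i))" for \<omega>
      by (simp add: sum_distrib_left mult_ac)
    have int': "integrable M (\<lambda>\<omega>. \<Sum>i\<in>UNIV. w \<omega> * Z i \<omega> * cnj (b $ i))"
      using int by (intro Bochner_Integration.integrable_sum integrable_mult_left) auto
    have "L \<bullet> b = Re (expectation (\<lambda>\<omega>. \<Sum>i\<in>UNIV. w \<omega> * Z i \<omega> * cnj (b $ i)))"
      unfolding inner_complex_vec L_def using int by simp
    also have "\<dots> = expectation (\<lambda>\<omega>. Re (\<Sum>i\<in>UNIV. w \<omega> * Z i \<omega> * cnj (b $ i)))"
      by (rule integral_Re[OF int', symmetric])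
    finally show "L \<bullet> b = expectation (\<lambda>\<omega>. Re (w \<omega> * (\<Sum>i\<in>UNIV. cnj (b $ i) * Z i \<omega>)))"
      unfolding * .
    show "integrable M (\<lambda>\<omega>. Re (w \<omega> * (\<Sum>i\<in>UNIV. cnj (b $ i) * Z i \<omega>)))"
      unfolding * by (rule integrable_Re[OF int'])
  qed
  have "L = (K / norm h') *\<^sub>R h'"
  proof (rule eq_scaleR_if_inner_le)
    fix b :: "complex ^ 'i"
    have mean: "has_bochner_integral M (\<lambda>\<omega>. cmod (\<Sum>i\<in>UNIV. cnj (b $ i) * Z i \<omega>)) (K * norm b)"
      using cn_linear_combination_cmod[OF Z \<open>c > 0\<close> indep, of "\<chi> i. cnj (b $ i)"]
      by (simp add: K_def norm_vec_def)
    have "L \<bullet> b \<le> expectation (\<lambda>\<omega>. cmod (\<Sum>i\<in>UNIV. cnj (b $ i) * Z i \<omega>))"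
      unfolding L using mean
      by (intro integral_mono intL)
        (auto simp: has_bochner_integral_iff norm_mult norm_w intro!: order_trans[OF complex_Re_le_cmod] simp del: times_complex.sel)
    then show "L \<bullet> b \<le> K * norm b"
      using mean by (simp add: has_bochner_integral_iff)
  next
    \<comment> \<open>At \<open>h'\<close> the sum is exactly the one whose phase \<open>w\<close>
      cancels, so it turns into its modulus.\<close>
    have "L \<bullet> h' = expectation (\<lambda>\<omega>. cmod (\<Sum>i\<in>UNIV. h $ i * Z i \<omega>))"
      unfolding L using conj_phase_mult_self
      by (intro Bochner_Integration.integral_cong) (simp_all add: h'_def w_def mult.commute[of "h $ _"] del: times_complex.sel)
    also have "\<dots> = K * norm h"
      using cn_linear_combination_cmod[OF Z \<open>c > 0\<close> indep, of h] by (simp add: has_bochner_integral_iff K_def)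
    finally show "L \<bullet> h' = K * norm h'"
      by (simp add: h'_def norm_vec_def)
  next
    show "h' \<noteq> 0"
      using \<open>h \<noteq> 0\<close> by (simp add: h'_def vec_eq_iff)
  qed
  moreover have "norm h' = norm h"
    by (simp add: h'_def norm_vec_def)
  ultimately have "L $ i = (K / norm h) *\<^sub>R cnj (h $ i)"
    by (simp add: h'_def)
  then show ?thesis
    by (simp add: L_def w_def K_def scaleR_conv_of_real)
qed

section \<open>Independence of rows, and conditioning on one of two independent variables\<close>

text \<open>Serves to pick one row out of the doubly indexed entries of \<open>G\<close>;
  injectivity makes the singleton blocks \<open>{f j}\<close> disjoint.\<close>

lemma indep_vars_reindex:
  assumes indep: "indep_vars (\<lambda>_. N) X UNIV" and "inj f"
  shows "indep_vars (\<lambda>_. N) (\<lambda>j. X (f j)) UNIV"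
proof -
  have "indep_vars (\<lambda>j. PiM {f j} (\<lambda>_. N)) (\<lambda>j \<omega>. restrict (\<lambda>i. X i \<omega>) {f j}) UNIV"
    using \<open>inj f\<close> by (intro indep_vars_restrict[OF indep]) (auto simp: disjoint_family_on_def inj_eq)
  from indep_vars_compose2[OF this, of "\<lambda>j x. x (f j)" "\<lambda>_. N"]
  show ?thesis
    by simp
qed

text \<open>Functions of disjoint blocks of an independent family are independent. \<open>F\<close>
  may vary with the row, so that later one row alone can be conjugated.\<close>

lemma indep_vars_rows:
  fixes X :: "'d \<times> 'r \<Rightarrow> 'a \<Rightarrow> 'b"
  assumes indep: "indep_vars (\<lambda>_. N) X UNIV"
    and F: "\<And>i. F i \<in> measurable (PiM UNIV (\<lambda>_::'r. N)) (N' i)"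
  shows "indep_vars N' (\<lambda>i \<omega>. F i (\<lambda>j. X (i, j) \<omega>)) UNIV"
proof -
  have "indep_vars (\<lambda>i. PiM ({i} \<times> UNIV) (\<lambda>_. N)) (\<lambda>i \<omega>. restrict (\<lambda>p. X p \<omega>) ({i} \<times> UNIV)) UNIV"
    by (intro indep_vars_restrict[OF indep]) (auto simp: disjoint_family_on_def)
  moreover have "(\<lambda>x. F i (\<lambda>j. x (i, j))) \<in> measurable (PiM ({i} \<times> UNIV) (\<lambda>_. N)) (N' i)" for i
    by (rule measurable_compose[OF _ F], rule measurable_PiM_single')
      (auto simp: space_PiM PiE_def Pi_def intro!: measurable_component_singleton)
  ultimately show ?thesis
    by (auto dest: indep_vars_compose2[where Y="\<lambda>i x. F i (\<lambda>j. x (i, j))" and N=N'])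
qed

text \<open>Independence makes the joint law the product of the two laws, so Fubini allows
  \<open>X\<close> to be frozen first; the inner mean is almost surely the constant
  \<open>c\<close>.\<close>

lemma indep_random_variables_expectation:
  fixes f :: "'b \<times> 'c \<Rightarrow> 'e::{banach, second_countable_topology}"
  assumes indep: "indep_random_variables M S X T Y"
    and [measurable]: "f \<in> borel_measurable (S \<Otimes>\<^sub>M T)"
    and int: "integrable M (\<lambda>\<omega>. f (X \<omega>, Y \<omega>))"
    and AE: "AE \<omega> in M. expectation (\<lambda>\<omega>'. f (X \<omega>, Y \<omega>')) = c"
  shows "expectation (\<lambda>\<omega>. f (X \<omega>, Y \<omega>)) = c"
proof -
  have [measurable]: "X \<in> measurable M S" "Y \<in> measurable M T"
    using indep by (auto simp: indep_random_variables_def)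
  interpret X: prob_space "distr M S X"
    by (rule prob_space_distr) measurable
  interpret Y: prob_space "distr M T Y"
    by (rule prob_space_distr) measurable
  interpret XY: pair_sigma_finite "distr M S X" "distr M T Y" ..
  have joint: "distr M S X \<Otimes>\<^sub>M distr M T Y = distr M (S \<Otimes>\<^sub>M T) (\<lambda>\<omega>. (X \<omega>, Y \<omega>))"
  proof (rule pair_measure_eqI)
    show "sigma_finite_measure (distr M S X)" "sigma_finite_measure (distr M T Y)" by unfold_locales
    fix A B assume "A \<in> sets (distr M S X)" "B \<in> sets (distr M T Y)"
    then have [measurable]: "A \<in> sets S" "B \<in> sets T"
      by auto
    have "prob ((X -` A \<inter> space M) \<inter> (Y -` B \<inter> space M)) = prob (X -` A \<inter> space M) * prob (Y -` B \<inter> space M)"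
      using indep by (intro indep_setD) (auto simp: indep_random_variables_def)
    also have "(X -` A \<inter> space M) \<inter> (Y -` B \<inter> space M) = (\<lambda>\<omega>. (X \<omega>, Y \<omega>)) -` (A \<times> B) \<inter> space M"
      by auto
    finally show "emeasure (distr M S X) A * emeasure (distr M T Y) B
        = emeasure (distr M (S \<Otimes>\<^sub>M T) (\<lambda>\<omega>. (X \<omega>, Y \<omega>))) (A \<times> B)"
      by (simp add: emeasure_distr emeasure_eq_measure ennreal_mult)
  qed simp
  have "integrable (distr M (S \<Otimes>\<^sub>M T) (\<lambda>\<omega>. (X \<omega>, Y \<omega>))) f"
    using int by (simp add: integrable_distr_eq)
  then have "integrable (distr M S X \<Otimes>\<^sub>M distr M T Y) f"
    by (simp only: joint)
  from XY.integral_fst'[OF this]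
  have "expectation (\<lambda>\<omega>. f (X \<omega>, Y \<omega>)) = (\<integral>x. (\<integral>y. f (x, y) \<partial>distr M T Y) \<partial>distr M S X)"
    unfolding joint by (simp add: integral_distr)
  also have "\<dots> = expectation (\<lambda>\<omega>. \<integral>y. f (X \<omega>, y) \<partial>distr M T Y)"
    by (subst integral_distr) measurable
  also have "\<dots> = expectation (\<lambda>\<omega>. c)"
  proof (rule integral_cong_AE)
    show "AE \<omega> in M. (\<integral>y. f (X \<omega>, y) \<partial>distr M T Y) = c"
      using AE AE_space
    proof eventually_elim
      case (elim \<omega>)
      \<comment> \<open>Measurability of the section of \<open>f\<close> is available at points of
        \<open>space S\<close>, hence the appeal to \<open>AE_space\<close>.\<close>
      have [measurable]: "X \<omega> \<in> space S"
        using elim(2) by (rule measurable_space[rotated]) measurable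
      show ?case
        by (subst integral_distr) (use elim in auto)
    qed
  qed measurable
  finally show ?thesis
    by (simp add: prob_space)
qed

end

section \<open>The diagonal entry as a squared row norm\<close>

text \<open>With \<open>h\<close> the column \<open>k\<close> of \<open>H\<close>, summing over
  \<open>i\<close> and dividing by the square root of \<open>CARD('d)\<close> gives entry (k, l) of
  \<open>phase_aligning G H ** G\<close>.\<close>

definition phased_row :: "complex ^ 'r::finite \<Rightarrow> complex ^ 'r ^ 'd \<Rightarrow> 'd \<Rightarrow> 'r \<Rightarrow> complex" where
  "phased_row h g i l = conj_phase (\<Sum>j\<in>UNIV. g $ i $ j * h $ j) * g $ i $ l"

definition aligned_power :: "complex ^ 'r::finite \<Rightarrow> complex ^ 'r ^ 'd::finite \<Rightarrow> complex" where
  "aligned_power h g = (\<Sum>l\<in>UNIV. \<Sum>i\<in>UNIV. \<Sum>j\<in>UNIV. phased_row h g i l * cnj (phased_row h g j l)) / of_nat CARD('d)"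

lemma conj_transpose_matrix_mult: "conj_transpose (A ** B) = conj_transpose B ** conj_transpose A"
  by (simp add: conj_transpose_def matrix_matrix_mult_def vec_eq_iff mult.commute)

text \<open>The matrix is \<open>?W ** G\<close> times its own conjugate transpose, so the entry is
  the squared norm of row \<open>k\<close> of \<open>?W ** G\<close>. That row depends on
  \<open>H\<close> through column \<open>k\<close> alone.\<close>

lemma phase_aligning_diagonal_entry:
  fixes G :: "complex ^ 'r::finite ^ 'd::finite" and H :: "complex ^ 'k ^ 'r"
  shows "(phase_aligning G H ** G ** conj_transpose G ** conj_transpose (phase_aligning G H)) $ k $ k
    = aligned_power (column k H) G"
proof -
  let ?W = "phase_aligning G H"
  have W: "?W $ k $ i = of_real (1 / sqrt (real CARD('d))) * conj_phase (\<Sum>j\<in>UNIV. G $ i $ j * column k H $ j)" for i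
    by (simp add: phase_aligning_def conj_phase_def conj_transpose_def matrix_matrix_mult_def column_def)
  have WG: "(?W ** G) $ k $ l = of_real (1 / sqrt (real CARD('d))) * (\<Sum>i\<in>UNIV. phased_row (column k H) G i l)" for l
    by (simp add: matrix_matrix_mult_def W phased_row_def sum_distrib_left mult.assoc)
  have sq: "complex_of_real (1 / sqrt (real CARD('d))) * complex_of_real (1 / sqrt (real CARD('d))) = 1 / of_nat CARD('d)"
    by (simp flip: of_real_mult)
  have "?W ** G ** conj_transpose G ** conj_transpose ?W = (?W ** G) ** conj_transpose (?W ** G)"
    by (simp add: conj_transpose_matrix_mult matrix_mul_assoc)
  then have "(?W ** G ** conj_transpose G ** conj_transpose ?W) $ k $ k
      = (\<Sum>l\<in>UNIV. (?W ** G) $ k $ l * cnj ((?W ** G) $ k $ l))"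
    by (simp add: matrix_matrix_mult_def[of "?W ** G"] conj_transpose_def)
  also have "\<dots> = (\<Sum>l\<in>UNIV. (complex_of_real (1 / sqrt (real CARD('d))) * complex_of_real (1 / sqrt (real CARD('d)))) *
      ((\<Sum>i\<in>UNIV. phased_row (column k H) G i l) * cnj (\<Sum>i\<in>UNIV. phased_row (column k H) G i l)))"
    unfolding WG by (intro sum.cong refl) (simp only: complex_cnj_mult complex_cnj_complex_of_real mult_ac)
  also have "\<dots> = aligned_power (column k H) G"
    unfolding sq by (simp add: aligned_power_def sum_product sum_divide_distrib)
  finally show ?thesis .
qed

lemma norm_phased_row [simp]: "cmod (phased_row h g i l) = cmod (g $ i $ l)"
  by (simp add: phased_row_def norm_mult)

lemma borel_measurable_matrix_entry [measurable]:
  "(\<lambda>g :: complex ^ 'r ^ 'd. g $ i $ j) \<in> borel_measurable borel"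
  by (intro borel_measurable_continuous_onI continuous_intros)

lemma borel_measurable_vec_entry [measurable]: "(\<lambda>g :: complex ^ 'r. g $ i) \<in> borel_measurable borel"
  by (intro borel_measurable_continuous_onI continuous_intros)

lemma borel_measurable_cnj [measurable]: "cnj \<in> borel_measurable borel"
  by (intro borel_measurable_continuous_onI continuous_intros)

lemma measurable_phased_row [measurable (raw)]:
  fixes h :: "'x \<Rightarrow> complex ^ 'r::finite" and g :: "'x \<Rightarrow> complex ^ 'r ^ 'd::finite"
  assumes [measurable]: "h \<in> borel_measurable N" "g \<in> borel_measurable N"
  shows "(\<lambda>x. phased_row (h x) (g x) i l) \<in> borel_measurable N"
  unfolding phased_row_def by measurable

lemma measurable_aligned_power [measurable (raw)]:
  fixes h :: "'x \<Rightarrow> complex ^ 'r::finite" and g :: "'x \<Rightarrow> complex ^ 'r ^ 'd::finite"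
  assumes [measurable]: "h \<in> borel_measurable N" "g \<in> borel_measurable N"
  shows "(\<lambda>x. aligned_power (h x) (g x)) \<in> borel_measurable N"
  unfolding aligned_power_def
  by (intro borel_measurable_divide borel_measurable_sum) measurable

section \<open>Expectations over \<open>G\<close> for a given column\<close>

context prob_space
begin

context
  fixes G :: "'a \<Rightarrow> complex ^ 'r::finite ^ 'd::finite" and \<eta> :: real
  assumes indep: "indep_vars (\<lambda>_. borel) (\<lambda>(i, j) \<omega>. G \<omega> $ i $ j) (UNIV :: ('d \<times> 'r) set)"
    and G: "\<And>i j. distributed M lborel (\<lambda>\<omega>. G \<omega> $ i $ j) (\<lambda>z. ennreal (cn_density \<eta> z))"
    and \<eta>: "\<eta> > 0"
begin

text \<open>Phases have modulus one, so two squared entries of \<open>G\<close> dominate the product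
  whatever \<open>h\<close> is. A random \<open>h\<close> covers both a fixed vector and the column
  of \<open>H\<close>.\<close>

lemma integrable_phased_row_product:
  assumes [measurable]: "h \<in> borel_measurable M" "G \<in> borel_measurable M"
  shows "integrable M (\<lambda>\<omega>. phased_row (h \<omega>) (G \<omega>) i l * cnj (phased_row (h \<omega>) (G \<omega>) j l))"
proof (rule Bochner_Integration.integrable_bound)
  show "integrable M (\<lambda>\<omega>. (cmod (G \<omega> $ i $ l))\<^sup>2 + (cmod (G \<omega> $ j $ l))\<^sup>2)"
    by (intro Bochner_Integration.integrable_add cn_second_moment(1)[OF G \<eta>])
  show "(\<lambda>\<omega>. phased_row (h \<omega>) (G \<omega>) i l * cnj (phased_row (h \<omega>) (G \<omega>) j l)) \<in> borel_measurable M"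
    by measurable
  have "x * y \<le> x\<^sup>2 + y\<^sup>2" if "x \<ge> 0" "y \<ge> 0" for x y :: real
    using sum_squares_bound[of x y] mult_nonneg_nonneg[OF that] by linarith
  then show "AE \<omega> in M. norm (phased_row (h \<omega>) (G \<omega>) i l * cnj (phased_row (h \<omega>) (G \<omega>) j l))
      \<le> norm ((cmod (G \<omega> $ i $ l))\<^sup>2 + (cmod (G \<omega> $ j $ l))\<^sup>2)"
    by (simp add: norm_mult)
qed

lemma integrable_aligned_power:
  assumes "h \<in> borel_measurable M" "G \<in> borel_measurable M"
  shows "integrable M (\<lambda>\<omega>. aligned_power (h \<omega>) (G \<omega>))"
  unfolding aligned_power_def
  by (intro Bochner_Integration.integrable_divide_zero Bochner_Integration.integrable_sum integrable_phased_row_product[OF assms] impI)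

lemma expectation_phased_row:
  assumes "h \<noteq> 0"
  shows "expectation (\<lambda>\<omega>. phased_row h (G \<omega>) i l) = of_real (sqrt (pi * \<eta>) / 2 / norm h) * cnj (h $ l)"
  unfolding phased_row_def
  using indep_vars_reindex[OF indep, of "\<lambda>j. (i, j)"]
  by (intro cn_conj_phase_expectation[OF G \<eta>] assms) (simp add: inj_on_def)

lemma expectation_phased_row_product:
  assumes "h \<noteq> 0" and Gm [measurable]: "G \<in> borel_measurable M"
  shows "expectation (\<lambda>\<omega>. phased_row h (G \<omega>) i l * cnj (phased_row h (G \<omega>) j l))
    = of_real (if i = j then \<eta> else pi * \<eta> / 4 * (cmod (h $ l) / norm h)\<^sup>2)"
proof (cases "i = j")
  case True
  have "expectation (\<lambda>\<omega>. phased_row h (G \<omega>) i l * cnj (phased_row h (G \<omega>) i l))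
      = expectation (\<lambda>\<omega>. of_real ((cmod (G \<omega> $ i $ l))\<^sup>2))"
    by (simp only: complex_norm_square[symmetric] norm_phased_row)
  then show ?thesis
    using True cn_second_moment[OF G \<eta>, of i l] by (simp del: of_real_power)
next
  case False
  \<comment> \<open>Putting the conjugation into the map of row \<open>j\<close> turns the integrand
    into a product of independent factors over \<open>{i, j}\<close>.\<close>
  define F where "F m x = (if m = j then cnj else id)
      (conj_phase (\<Sum>j\<in>UNIV. x j * h $ j) * x l)" for m :: 'd and x :: "'r \<Rightarrow> complex"
  have F: "F m (\<lambda>j. G \<omega> $ m $ j) = (if m = j then cnj else id) (phased_row h (G \<omega>) m l)" for m \<omega>
    by (simp add: F_def phased_row_def)
  have "indep_vars (\<lambda>_. borel) (\<lambda>m \<omega>. F m (\<lambda>j. (\<lambda>(i, j) \<omega>. G \<omega> $ i $ j) (m, j) \<omega>)) UNIV"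
    by (rule indep_vars_rows[OF indep]) (auto simp: F_def id_def)
  then have "indep_vars (\<lambda>_. borel) (\<lambda>m \<omega>. (if m = j then cnj else id) (phased_row h (G \<omega>) m l)) {i, j}"
    by (intro indep_vars_subset[where J="{i, j}" and I=UNIV]) (simp_all add: F)
  moreover have int: "integrable M (\<lambda>\<omega>. phased_row h (G \<omega>) m l)" for m
    by (intro Bochner_Integration.integrable_bound[OF cn_integrable[OF G \<eta>, of m l]]) auto
  ultimately have "expectation (\<lambda>\<omega>. \<Prod>m\<in>{i, j}. (if m = j then cnj else id) (phased_row h (G \<omega>) m l))
      = (\<Prod>m\<in>{i, j}. expectation (\<lambda>\<omega>. (if m = j then cnj else id) (phased_row h (G \<omega>) m l)))"
    by (intro indep_vars_lebesgue_integral) auto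
  then have "expectation (\<lambda>\<omega>. phased_row h (G \<omega>) i l * cnj (phased_row h (G \<omega>) j l))
      = expectation (\<lambda>\<omega>. phased_row h (G \<omega>) i l) * cnj (expectation (\<lambda>\<omega>. phased_row h (G \<omega>) j l))"
    using False by simp
  \<comment> \<open>Both rows have the same mean, so the product is the squared modulus of that
    mean.\<close>
  also have "\<dots> = of_real ((sqrt (pi * \<eta>) / 2 / norm h)\<^sup>2 * (cmod (h $ l))\<^sup>2)"
  proof -
    have "of_real a * cnj x * cnj (of_real a * cnj x) = of_real (a\<^sup>2 * (cmod x)\<^sup>2)" for a x
      using complex_norm_square[of x] by (simp add: power2_eq_square mult.commute[of "cnj x"])
    then show ?thesis
      unfolding expectation_phased_row[OF \<open>h \<noteq> 0\<close>] .
  qed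
  also have "(sqrt (pi * \<eta>) / 2 / norm h)\<^sup>2 * (cmod (h $ l))\<^sup>2 = pi * \<eta> / 4 * (cmod (h $ l) / norm h)\<^sup>2"
    using \<eta> by (simp add: power_divide)
  finally show ?thesis
    using False by simp
qed

text \<open>The weights \<open>?q l\<close> sum to one, so the direction of \<open>h\<close> drops
  out. Each row has \<open>?N - 1\<close> partners, and division by \<open>?N\<close> cancels the
  sum over rows; the pairs \<open>i = j\<close> leave \<eta> for each of the \<open>CARD('r)\<close>
  columns.\<close>

lemma expectation_aligned_power:
  assumes "h \<noteq> 0" and Gm: "G \<in> borel_measurable M"
  shows "expectation (\<lambda>\<omega>. aligned_power h (G \<omega>))
    = of_real (\<eta> * (pi / 4 * real CARD('d) + real CARD('r) - pi / 4))"
proof -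
  let ?N = "real CARD('d)" and ?q = "\<lambda>l. (cmod (h $ l) / norm h)\<^sup>2"
  have "(\<Sum>l\<in>UNIV. (cmod (h $ l))\<^sup>2) = (norm h)\<^sup>2"
    by (simp add: norm_vec_def L2_set_def sum_nonneg)
  then have q: "(\<Sum>l\<in>UNIV. ?q l) = 1"
    using \<open>h \<noteq> 0\<close> by (simp add: power_divide flip: sum_divide_distrib)
  have inner: "(\<Sum>j\<in>UNIV. if i = j then \<eta> else p) = \<eta> + (?N - 1) * p" for i :: 'd and p :: real
  proof -
    have "(\<Sum>j\<in>UNIV. if i = j then \<eta> else p) = \<eta> + (\<Sum>j\<in>UNIV - {i}. p)"
      by (subst sum.remove[of _ i]) (auto intro!: sum.cong)
    then show ?thesis
      by (simp add: card_Diff_singleton of_nat_diff Suc_leI)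
  qed
  have int: "integrable M (\<lambda>\<omega>. phased_row h (G \<omega>) i l * cnj (phased_row h (G \<omega>) j l))" for i j l
    using integrable_phased_row_product[of "\<lambda>_. h"] Gm by simp
  have "expectation (\<lambda>\<omega>. aligned_power h (G \<omega>))
      = (\<Sum>l\<in>UNIV. \<Sum>i\<in>UNIV. \<Sum>j\<in>UNIV. expectation (\<lambda>\<omega>. phased_row h (G \<omega>) i l * cnj (phased_row h (G \<omega>) j l))) / of_nat CARD('d)"
    unfolding aligned_power_def using int by simp
  also have "\<dots> = of_real ((\<Sum>l\<in>UNIV. \<Sum>i\<in>(UNIV::'d set). \<Sum>j\<in>UNIV. if i = j then \<eta> else pi * \<eta> / 4 * ?q l) / ?N)"
    by (simp only: expectation_phased_row_product[OF assms] of_real_sum of_real_divide of_real_of_nat_eq)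
  also have "(\<Sum>l\<in>UNIV. \<Sum>i\<in>(UNIV::'d set). \<Sum>j\<in>UNIV. if i = j then \<eta> else pi * \<eta> / 4 * ?q l) / ?N
      = real CARD('r) * \<eta> + (?N - 1) * (pi * \<eta> / 4) * (\<Sum>l\<in>UNIV. ?q l)"
  proof -
    have "(\<Sum>l\<in>(UNIV::'r set). \<Sum>i\<in>(UNIV::'d set). x l) / ?N = (\<Sum>l\<in>UNIV. x l)" for x
      by (simp flip: sum_distrib_left)
    then show ?thesis
      unfolding inner by (simp add: sum.distrib sum_distrib_left mult.assoc)
  qed
  also have "\<dots> = \<eta> * (pi / 4 * ?N + real CARD('r) - pi / 4)"
    unfolding q by (simp add: field_simps)
  finally show ?thesis .
qed

end

end

section \<open>Conditioning on \<open>H\<close>\<close>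

theorem proposition1:
  fixes M :: "'a measure"
    and H :: "'a \<Rightarrow> complex ^ 'k::finite ^ 'r::finite"
    and G :: "'a \<Rightarrow> complex ^ 'r ^ 'd::finite"
    and \<eta> :: real
    and \<xi> :: "'k \<Rightarrow> real"
    and k :: 'k
  assumes "prob_space M"
    and "\<eta> > 0"
    and "\<And>j. \<xi> j > 0"
    and "indep_random_variables M borel H borel G"
    and "\<And>j. distributed M lborel (\<lambda>\<omega>. column j (H \<omega>)) (\<lambda>z. ennreal (cn_vec_density (\<xi> j) z))"
    and "prob_space.indep_vars M (\<lambda>_. borel) (\<lambda>(i, j) \<omega>. G \<omega> $ i $ j) (UNIV :: ('d \<times> 'r) set)"
    and "\<And>i j. distributed M lborel (\<lambda>\<omega>. G \<omega> $ i $ j) (\<lambda>z. ennreal (cn_density \<eta> z))"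
  shows "(LINT \<omega>|M.
            (let W = phase_aligning (G \<omega>) (H \<omega>)
             in (W ** G \<omega> ** conj_transpose (G \<omega>) ** conj_transpose W) $ k $ k))
         = complex_of_real (\<eta> * (pi / 4 * real CARD('d) + real CARD('r) - pi / 4))"
proof -
  interpret prob_space M by fact
  note indep_HG = assms(4) and indep_G = assms(6) and G = assms(7)
  have Hm: "H \<in> borel_measurable M" and Gm: "G \<in> borel_measurable M"
    using indep_HG by (auto simp: indep_random_variables_def)
  have col[measurable]: "(column k :: complex ^ 'k ^ 'r \<Rightarrow> _) \<in> borel_measurable borel"
    unfolding column_def by (intro borel_measurable_continuous_onI continuous_intros)
  have colH: "(\<lambda>\<omega>. column k (H \<omega>)) \<in> borel_measurable M"
    using Hm by (rule measurable_compose) (rule col)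
  \<comment> \<open>The column has a density with respect to Lebesgue measure, for which a single
    point is null.\<close>
  have nonzero: "AE \<omega> in M. column k (H \<omega>) \<noteq> 0"
  proof -
    have "AE z in lborel. z \<noteq> (0 :: complex ^ 'r)"
      by (rule AE_lborel_singleton)
    then have "AE z in distr M lborel (\<lambda>\<omega>. column k (H \<omega>)). z \<noteq> 0"
      unfolding distributed_distr_eq_density[OF assms(5)]
      using distributed_borel_measurable[OF assms(5), of k] by (subst AE_density) auto
    then show ?thesis
      using colH by (subst (asm) AE_distr_iff) auto
  qed
  have "expectation (\<lambda>\<omega>. (\<lambda>(A, g). aligned_power (column k A) g) (H \<omega>, G \<omega>))
      = of_real (\<eta> * (pi / 4 * real CARD('d) + real CARD('r) - pi / 4))"
  \<comment> \<open>With \<open>H\<close> frozen, the mean over \<open>G\<close> is the same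
    constant for every value of \<open>H\<close> whose column \<open>k\<close> is nonzero.\<close>
  proof (rule indep_random_variables_expectation[OF indep_HG])
    have "(\<lambda>p :: (complex ^ 'k ^ 'r) \<times> (complex ^ 'r ^ 'd). column k (fst p)) \<in> borel_measurable (borel \<Otimes>\<^sub>M borel)"
      by (rule measurable_compose[OF measurable_fst col])
    then show "(\<lambda>(A :: complex ^ 'k ^ 'r, g :: complex ^ 'r ^ 'd). aligned_power (column k A) g)
        \<in> borel_measurable (borel \<Otimes>\<^sub>M borel)"
      unfolding case_prod_beta by (intro measurable_aligned_power measurable_snd)
    show "integrable M (\<lambda>\<omega>. (\<lambda>(A, g). aligned_power (column k A) g) (H \<omega>, G \<omega>))"
      using integrable_aligned_power[OF indep_G G \<open>\<eta> > 0\<close> colH Gm] by simp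
    show "AE \<omega> in M. expectation (\<lambda>\<omega>'. (\<lambda>(A, g). aligned_power (column k A) g) (H \<omega>, G \<omega>'))
        = of_real (\<eta> * (pi / 4 * real CARD('d) + real CARD('r) - pi / 4))"
      using nonzero
      by eventually_elim (simp add: expectation_aligned_power[OF indep_G G \<open>\<eta> > 0\<close> _ Gm] del: of_real_mult)
  qed
  then show ?thesis
    by (simp add: phase_aligning_diagonal_entry)
qed

end
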